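(* Let $\mathcal{R}$ be a ring with unity and let $p,q,r\in\mathcal{R}$ be idempotents. Let $a_1,a_2\in\mathcal{R}$ and suppose that $a_1$ is Bott-Duffin $(p,q)$-invertible and $a_2$ is Bott-Duffin $(r,p)$-invertible. Then the following statements are equivalent. (i) $qa_1(1-p)a_2r=0$. (ii) The element $a_1a_2$ is Bott-Duffin $(r,q)$-invertible and $$(a_1a_2)^{-(r,\,q)}=a_2^{-(r,\,p)}a_1^{-(p,\,q)}.$$
   Context: Given idempotents $p,q$ in a ring $\mathcal{R}$ with unity, an element $a\in\mathcal{R}$ is Bott-Duffin $(p,q)$-invertible if there is $y\in\mathcal{R}$ with $y=py=yq$, $yap=p$ and $qay=q$. Such a $y$ is unique if it exists; it is denoted $a^{-(p,q)}$. *)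

theory Defs
  imports Main
begin

text \<open>A ring with unity is a type of sort \<open>{ring, monoid_mult}\<close>. Unlike \<open>ring_1\<close>, this sort
  does not require \<open>0 \<noteq> 1\<close>, so the zero ring is included.\<close>

definition idempotent :: "'a::times \<Rightarrow> bool" where
  "idempotent p \<longleftrightarrow> p * p = p"

definition is_bott_duffin_inverse ::
    "'a::{ring, monoid_mult} \<Rightarrow> 'a \<Rightarrow> 'a \<Rightarrow> 'a \<Rightarrow> bool" where
  "is_bott_duffin_inverse p q a y \<longleftrightarrow>
     y = p * y \<and> y = y * q \<and> y * a * p = p \<and> q * a * y = q"

definition bott_duffin_invertible ::
    "'a::{ring, monoid_mult} \<Rightarrow> 'a \<Rightarrow> 'a \<Rightarrow> bool" where
  "bott_duffin_invertible p q a \<longleftrightarrow> (\<exists>y. is_bott_duffin_inverse p q a y)"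

lemma is_bott_duffin_inverse_unique:
  assumes y: "is_bott_duffin_inverse p q a y" and z: "is_bott_duffin_inverse p q a z"
  shows "y = z"
proof -
  have "y = y * (q * a * z)"
    using y z by (simp add: is_bott_duffin_inverse_def)
  also have "\<dots> = (y * q) * a * z"
    by (simp add: mult.assoc)
  also have "\<dots> = y * a * (p * z)"
    using y z by (simp add: is_bott_duffin_inverse_def)
  also have "\<dots> = (y * a * p) * z"
    by (simp add: mult.assoc)
  also have "\<dots> = z"
    using y z by (simp add: is_bott_duffin_inverse_def)
  finally show ?thesis .
qed

text \<open>Unspecified unless \<open>a\<close> is Bott-Duffin \<open>(p, q)\<close>-invertible.\<close>

definition bott_duffin_inverse ::
    "'a::{ring, monoid_mult} \<Rightarrow> 'a \<Rightarrow> 'a \<Rightarrow> 'a" where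
  "bott_duffin_inverse p q a = (THE y. is_bott_duffin_inverse p q a y)"

lemma bott_duffin_inverse_eqI:
  "is_bott_duffin_inverse p q a y \<Longrightarrow> bott_duffin_inverse p q a = y"
  unfolding bott_duffin_inverse_def
  by (blast intro: the_equality is_bott_duffin_inverse_unique)

end

theory Submission
  imports Defs
begin

text \<open>Condition (i) says that a \<open>p\<close> can be inserted between the factors:
  \<open>q * a * b * r = q * a * p * b * r\<close>. Given inverses \<open>y\<close> of
  \<open>a\<close> and \<open>z\<close> of \<open>b\<close>, the candidate \<open>z * y\<close>
  absorbs \<open>r\<close> on the left and \<open>q\<close> on the right in any case. Once
  \<open>p\<close> is inserted, \<open>y * a * p = p\<close> and \<open>p * b * z = p\<close> make
  the inner factors collapse, giving the two remaining equations. Conversely, these equations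
  recover the insertion of \<open>p\<close>. Uniqueness of the inverse then turns this criterion for
  \<open>z * y\<close> into statement (ii).\<close>

lemma bott_duffin_inverse_mult_iff:
  assumes y: "is_bott_duffin_inverse p q a y" and z: "is_bott_duffin_inverse r p b z"
  shows "is_bott_duffin_inverse r q (a * b) (z * y) \<longleftrightarrow> q * a * (1 - p) * b * r = 0"
proof -
  have y1: "p * y = y" "y * q = y" "y * a * p = p" "q * a * y = q"
    using y by (simp_all add: is_bott_duffin_inverse_def)
  have z1: "r * z = z" "z * p = z" "z * b * r = r" "p * b * z = p"
    using z by (simp_all add: is_bott_duffin_inverse_def)
  have iff: "q * a * (1 - p) * b * r = 0 \<longleftrightarrow> q * a * b * r = q * a * p * b * r"
    by (simp add: algebra_simps)
  have "is_bott_duffin_inverse r q (a * b) (z * y)" if *: "q * a * b * r = q * a * p * b * r"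
  proof -
    \<comment> \<open>Writing \<open>y\<close> as \<open>y * q\<close> exposes the block
      \<open>q * a * b * r\<close>, to which the assumption applies.\<close>
    have "z * y * (a * b) * r = z * (y * q) * a * b * r"
      by (simp add: y1 mult.assoc)
    also have "\<dots> = z * y * (q * a * b * r)"
      by (simp add: mult.assoc)
    also have "\<dots> = z * y * (q * a * p * b * r)"
      by (simp only: *)
    also have "\<dots> = z * ((y * q) * a * p) * b * r"
      by (simp add: mult.assoc)
    also have "\<dots> = r"
      by (simp add: y1 z1)
    finally have left: "z * y * (a * b) * r = r" .
    \<comment> \<open>Dually, the missing \<open>r\<close> of the block is supplied by
      \<open>z = r * z\<close>.\<close>
    have "q * (a * b) * (z * y) = q * a * b * (r * z) * y"
      by (simp add: z1 mult.assoc)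
    also have "\<dots> = (q * a * b * r) * z * y"
      by (simp add: mult.assoc)
    also have "\<dots> = (q * a * p * b * r) * z * y"
      by (simp only: *)
    also have "\<dots> = q * a * (p * b * (r * z)) * y"
      by (simp add: mult.assoc)
    also have "\<dots> = q * a * (p * y)"
      \<comment> \<open>Associativity is restricted to regrouping \<open>p * y\<close>, so that
        \<open>p * b * z\<close> stays intact and rewrites to \<open>p\<close>.\<close>
      by (simp only: z1 mult.assoc[of _ p y])
    also have "\<dots> = q"
      by (simp add: y1)
    finally have right: "q * (a * b) * (z * y) = q" .
    have "r * (z * y) = z * y"
      by (simp add: z1 flip: mult.assoc)
    moreover have "z * y * q = z * y"
      by (simp add: y1 mult.assoc)
    ultimately show ?thesis
      using left right by (simp add: is_bott_duffin_inverse_def)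
  qed
  moreover have "q * a * b * r = q * a * p * b * r"
    if "is_bott_duffin_inverse r q (a * b) (z * y)"
  proof -
    \<comment> \<open>Multiplying this equation on the left by \<open>q * a * p * b\<close> gives
      the claim, since \<open>p * b * z * y = p * y = y\<close> and \<open>q * a * y = q\<close>.
      The chain below reads this backwards.\<close>
    have r: "z * y * (a * b) * r = r"
      using that by (simp add: is_bott_duffin_inverse_def)
    have "q * a * b * r = (q * a * y) * a * b * r"
      by (simp add: y1)
    also have "\<dots> = q * a * (p * y) * a * b * r"
      by (simp add: y1)
    also have "\<dots> = q * a * ((p * b * z) * y) * a * b * r"
      by (simp add: z1)
    also have "\<dots> = q * a * p * b * (z * y * (a * b) * r)"
      by (simp add: mult.assoc)
    also have "\<dots> = q * a * p * b * r"
      by (simp only: r)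
    finally show ?thesis .
  qed
  ultimately show ?thesis
    using iff by blast
qed

theorem corollary6p3:
  fixes p q r a\<^sub>1 a\<^sub>2 :: "'a::{ring, monoid_mult}"
  assumes "idempotent p" and "idempotent q" and "idempotent r"
    and "bott_duffin_invertible p q a\<^sub>1"
    and "bott_duffin_invertible r p a\<^sub>2"
  shows "q * a\<^sub>1 * (1 - p) * a\<^sub>2 * r = 0 \<longleftrightarrow>
    bott_duffin_invertible r q (a\<^sub>1 * a\<^sub>2) \<and>
    bott_duffin_inverse r q (a\<^sub>1 * a\<^sub>2) =
      bott_duffin_inverse r p a\<^sub>2 * bott_duffin_inverse p q a\<^sub>1"
proof -
  obtain y z where y: "is_bott_duffin_inverse p q a\<^sub>1 y"
    and z: "is_bott_duffin_inverse r p a\<^sub>2 z"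
    using assms(4,5) by (auto simp: bott_duffin_invertible_def)
  \<comment> \<open>Any witness of invertibility equals the value of
    \<open>bott_duffin_inverse\<close>, so that value is itself an inverse.\<close>
  have "bott_duffin_invertible r q (a\<^sub>1 * a\<^sub>2) \<and> bott_duffin_inverse r q (a\<^sub>1 * a\<^sub>2) = z * y
      \<longleftrightarrow> is_bott_duffin_inverse r q (a\<^sub>1 * a\<^sub>2) (z * y)"
    unfolding bott_duffin_invertible_def by (metis bott_duffin_inverse_eqI)
  then show ?thesis
    using bott_duffin_inverse_mult_iff[OF y z]
      bott_duffin_inverse_eqI[OF y] bott_duffin_inverse_eqI[OF z] by simp
qed

end
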